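(* Let $n\ge 2$ and let $(b,c,d)$ be a triad in the Cayley-Dickson algebra $\mathbb A_n$ that is non-associative, i.e. $T(b,c,d)\neq 0$. Then either all three of the Type 1, Type 2 and Type 3 associators of $(b,c,d)$ are non-zero, or exactly one of them is non-zero and the other two are zero.
   Context: The real algebras $\mathbb A_n$ are defined recursively: $\mathbb A_0=\mathbb R$ with trivial conjugation, and $\mathbb A_n=\mathbb A_{n-1}\oplus\mathbb A_{n-1}$ with $(x,y)(z,w)=(xz-w^*y,\; wx+yz^* )$ and $(x,y)^*=(x^*,-y)$. The graded basis of $\mathbb A_n$ is $\{\mathrm o_\alpha:\alpha\subseteq\{1,\dots,n\}\}$, with $\mathrm o_\emptyset=1$ and, for $\alpha\subseteq\{1,\dots,n-1\}$, $\mathrm o_\alpha=(\mathrm o_\alpha,0)$ and $\mathrm o_{\alpha\cup\{n\}}=(0,\mathrm o_\alpha)$. Pure basis elements are those with $\alpha\neq\emptyset$. The natural order on basis elements is: $\mathrm o_\alpha<\mathrm o_\beta$ iff $\alpha\ne\beta$ and the largest element of the symmetric difference of $\alpha$ and $\beta$ lies in $\beta$. A triad is a triple $(b,c,d)$ of pure basis elements with $b<c<d$. The associator is $[x,y,z]=(xy)z-x(yz)$. For a triad $(b,c,d)$, the Type 1, Type 2 and Type 3 associators are respectively $[b,d,c]$, $[b,c,d]$ and $[c,b,d]$. The triple associator is $T(b,c,d)=[b,d,c]-[d,c,b]+[c,b,d]$; the triad is called associative if $T(b,c,d)=0$ and non-associative otherwise. *)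

theory Defs
  imports Complex_Main
begin

text \<open>
  The algebras \<open>\<A>\<^sub>n\<close> have dimension depending on the variable \<open>n\<close>, so all of them live in one
  datatype of binary trees with real leaves; \<open>\<A>\<^sub>n\<close> is the set \<open>cd_carrier n\<close> of complete trees
  of depth \<open>n\<close>.  Operations on trees of different shapes are left unspecified.
\<close>

datatype cd = Scalar real | Pr cd cd

fun cd_carrier :: "nat \<Rightarrow> cd set" where
  "cd_carrier 0 = range Scalar"
| "cd_carrier (Suc n) = {Pr x y | x y. x \<in> cd_carrier n \<and> y \<in> cd_carrier n}"

fun cd_zero :: "nat \<Rightarrow> cd" where
  "cd_zero 0 = Scalar 0"
| "cd_zero (Suc n) = Pr (cd_zero n) (cd_zero n)"

fun cd_one :: "nat \<Rightarrow> cd" where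
  "cd_one 0 = Scalar 1"
| "cd_one (Suc n) = Pr (cd_one n) (cd_zero n)"

fun cd_neg :: "cd \<Rightarrow> cd" where
  "cd_neg (Scalar a) = Scalar (- a)"
| "cd_neg (Pr x y) = Pr (cd_neg x) (cd_neg y)"

fun cd_add :: "cd \<Rightarrow> cd \<Rightarrow> cd" where
  "cd_add (Scalar a) (Scalar b) = Scalar (a + b)"
| "cd_add (Pr x y) (Pr z w) = Pr (cd_add x z) (cd_add y w)"

definition cd_sub :: "cd \<Rightarrow> cd \<Rightarrow> cd" where
  "cd_sub x y = cd_add x (cd_neg y)"

fun cd_conj :: "cd \<Rightarrow> cd" where
  "cd_conj (Scalar a) = Scalar a"
| "cd_conj (Pr x y) = Pr (cd_conj x) (cd_neg y)"

lemma size_cd_neg [simp]: "size (cd_neg x) = size x"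
  by (induction x) auto

lemma size_cd_conj [simp]: "size (cd_conj x) = size x"
  by (induction x) auto

function (sequential) cd_mult :: "cd \<Rightarrow> cd \<Rightarrow> cd" where
  "cd_mult (Scalar a) (Scalar b) = Scalar (a * b)"
| "cd_mult (Pr x y) (Pr z w) =
     Pr (cd_sub (cd_mult x z) (cd_mult (cd_conj w) y))
        (cd_add (cd_mult w x) (cd_mult y (cd_conj z)))"
  by pat_completeness auto
termination
  by (relation "measure (\<lambda>(x, y). size x + size y)") auto

definition cd_assoc :: "cd \<Rightarrow> cd \<Rightarrow> cd \<Rightarrow> cd" where
  "cd_assoc x y z = cd_sub (cd_mult (cd_mult x y) z) (cd_mult x (cd_mult y z))"

text \<open>The element \<open>o\<^sub>\<alpha>\<close> of \<open>\<A>\<^sub>n\<close>, meaningful for \<open>\<alpha> \<subseteq> {1..n}\<close>.\<close>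

fun cd_basis :: "nat \<Rightarrow> nat set \<Rightarrow> cd" where
  "cd_basis 0 \<alpha> = Scalar 1"
| "cd_basis (Suc n) \<alpha> =
     (if Suc n \<in> \<alpha> then Pr (cd_zero n) (cd_basis n (\<alpha> - {Suc n}))
      else Pr (cd_basis n \<alpha>) (cd_zero n))"

definition pure_basis :: "nat \<Rightarrow> cd set" where
  "pure_basis n = {cd_basis n \<alpha> | \<alpha>. \<alpha> \<subseteq> {1..n} \<and> \<alpha> \<noteq> {}}"

text \<open>The index sets below are uniquely determined by \<open>x\<close> and \<open>y\<close>, see \<open>inj_on_cd_basis\<close>.\<close>

definition basis_less :: "nat \<Rightarrow> cd \<Rightarrow> cd \<Rightarrow> bool" where
  "basis_less n x y \<longleftrightarrow>
     (\<exists>\<alpha> \<beta>. \<alpha> \<subseteq> {1..n} \<and> \<beta> \<subseteq> {1..n} \<and> x = cd_basis n \<alpha> \<and> y = cd_basis n \<beta> \<and>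
            \<alpha> \<noteq> \<beta> \<and> Max ((\<alpha> - \<beta>) \<union> (\<beta> - \<alpha>)) \<in> \<beta>)"

definition triad :: "nat \<Rightarrow> cd \<Rightarrow> cd \<Rightarrow> cd \<Rightarrow> bool" where
  "triad n b c d \<longleftrightarrow>
     b \<in> pure_basis n \<and> c \<in> pure_basis n \<and> d \<in> pure_basis n \<and>
     basis_less n b c \<and> basis_less n c d"

definition type1_assoc :: "cd \<Rightarrow> cd \<Rightarrow> cd \<Rightarrow> cd" where
  "type1_assoc b c d = cd_assoc b d c"

definition type2_assoc :: "cd \<Rightarrow> cd \<Rightarrow> cd \<Rightarrow> cd" where
  "type2_assoc b c d = cd_assoc b c d"

definition type3_assoc :: "cd \<Rightarrow> cd \<Rightarrow> cd \<Rightarrow> cd" where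
  "type3_assoc b c d = cd_assoc c b d"

definition triple_assoc :: "cd \<Rightarrow> cd \<Rightarrow> cd \<Rightarrow> cd" where
  "triple_assoc b c d = cd_add (cd_sub (cd_assoc b d c) (cd_assoc d c b)) (cd_assoc c b d)"

definition nonassociative_triad :: "nat \<Rightarrow> cd \<Rightarrow> cd \<Rightarrow> cd \<Rightarrow> bool" where
  "nonassociative_triad n b c d \<longleftrightarrow> triad n b c d \<and> triple_assoc b c d \<noteq> cd_zero n"

lemma cd_zero_carrier: "cd_zero n \<in> cd_carrier n"
  by (induction n) auto

lemma cd_neg_carrier: "x \<in> cd_carrier n \<Longrightarrow> cd_neg x \<in> cd_carrier n"
  by (induction n arbitrary: x) auto

lemma cd_add_carrier:
  "x \<in> cd_carrier n \<Longrightarrow> y \<in> cd_carrier n \<Longrightarrow> cd_add x y \<in> cd_carrier n"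
  by (induction n arbitrary: x y) auto

lemma cd_sub_carrier:
  "x \<in> cd_carrier n \<Longrightarrow> y \<in> cd_carrier n \<Longrightarrow> cd_sub x y \<in> cd_carrier n"
  by (simp add: cd_sub_def cd_add_carrier cd_neg_carrier)

lemma cd_conj_carrier: "x \<in> cd_carrier n \<Longrightarrow> cd_conj x \<in> cd_carrier n"
  by (induction n arbitrary: x) (auto simp: cd_neg_carrier)

lemma cd_mult_carrier:
  "x \<in> cd_carrier n \<Longrightarrow> y \<in> cd_carrier n \<Longrightarrow> cd_mult x y \<in> cd_carrier n"
  by (induction n arbitrary: x y) (auto simp: cd_add_carrier cd_sub_carrier cd_conj_carrier)

lemma cd_basis_carrier: "cd_basis n \<alpha> \<in> cd_carrier n"
  by (induction n arbitrary: \<alpha>) (auto simp: cd_zero_carrier)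

lemma cd_basis_empty: "cd_basis n {} = cd_one n"
  by (induction n) auto

lemma cd_basis_nonzero: "cd_basis n \<alpha> \<noteq> cd_zero n"
  by (induction n arbitrary: \<alpha>) auto

lemma inj_on_cd_basis: "inj_on (cd_basis n) (Pow {1..n})"
proof (induction n)
  case 0
  show ?case by (auto simp: inj_on_def)
next
  case (Suc n)
  show ?case
  proof (rule inj_onI)
    fix \<alpha> \<beta>
    assume sub: "\<alpha> \<in> Pow {1..Suc n}" "\<beta> \<in> Pow {1..Suc n}"
      and eq: "cd_basis (Suc n) \<alpha> = cd_basis (Suc n) \<beta>"
    have restr: "\<gamma> - {Suc n} \<in> Pow {1..n}" if "\<gamma> \<in> Pow {1..Suc n}" for \<gamma>
      using that by (auto simp: le_Suc_eq subset_iff)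
    have mem: "Suc n \<in> \<alpha> \<longleftrightarrow> Suc n \<in> \<beta>"
      using eq cd_basis_nonzero[of n] by (auto split: if_splits)
    then have "cd_basis n (\<alpha> - {Suc n}) = cd_basis n (\<beta> - {Suc n})"
      using eq by (auto split: if_splits)
    then have "\<alpha> - {Suc n} = \<beta> - {Suc n}"
      using Suc restr[OF sub(1)] restr[OF sub(2)] by (auto dest: inj_onD)
    with mem show "\<alpha> = \<beta>" by blast
  qed
qed

end

theory Submission
  imports Defs
begin

text \<open>
  Products of basis elements are basis elements up to sign, so every associator of basis elements
  is a multiple of a single basis element. Put \<open>A = b(cd)\<close>, \<open>B = c(bd)\<close>, \<open>C = (bc)d\<close>. If \<open>bc\<close> is not
  \<open>\<plusminus>d\<close>, then all the pairs of factors involved anticommute, and the Type 1, 2 and 3 associators are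
  \<open>A - B\<close>, \<open>C - A\<close> and \<open>-C - B\<close>. As \<open>A\<close>, \<open>B\<close>, \<open>C\<close> agree up to sign, if \<open>B = C\<close> then the third is
  non-zero and the first two vanish together, and if \<open>B = -C\<close> then the third is zero and exactly one
  of the first two is non-zero. If \<open>bc = \<plusminus>d\<close>, then \<open>(xy)y = -x\<close> for distinct pure basis elements makes
  all associators vanish, so this case is excluded by \<open>T \<noteq> 0\<close>.
\<close>

section \<open>Arithmetic of zero and of real multiples of basis elements\<close>

lemma cd_add_zero:
  "x \<in> cd_carrier n \<Longrightarrow> cd_add x (cd_zero n) = x"
  "x \<in> cd_carrier n \<Longrightarrow> cd_add (cd_zero n) x = x"
  by (induction n arbitrary: x) auto

lemma cd_neg_zero: "cd_neg (cd_zero n) = cd_zero n"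
  by (induction n) auto

lemma cd_conj_zero: "cd_conj (cd_zero n) = cd_zero n"
  by (induction n) (auto simp: cd_neg_zero)

lemma cd_mult_zero:
  "x \<in> cd_carrier n \<Longrightarrow> cd_mult x (cd_zero n) = cd_zero n \<and> cd_mult (cd_zero n) x = cd_zero n"
  by (induction n arbitrary: x)
    (auto simp: cd_conj_zero cd_neg_zero cd_sub_def cd_add_zero cd_zero_carrier cd_conj_carrier)

text \<open>The multiple \<open>t o\<^sub>\<alpha>\<close>. Unlike the basis itself, these multiples
  are closed under negation and products, and under sums for a fixed index set, so they contain all
  associators of basis elements.\<close>

fun cd_mono :: "nat \<Rightarrow> real \<Rightarrow> nat set \<Rightarrow> cd" where
  "cd_mono 0 t \<alpha> = Scalar t"
| "cd_mono (Suc n) t \<alpha> =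
     (if Suc n \<in> \<alpha> then Pr (cd_zero n) (cd_mono n t (\<alpha> - {Suc n}))
      else Pr (cd_mono n t \<alpha>) (cd_zero n))"

lemma cd_mono_carrier: "cd_mono n t \<alpha> \<in> cd_carrier n"
  by (induction n arbitrary: \<alpha>) (auto simp: cd_zero_carrier)

lemma cd_basis_eq_mono: "cd_basis n \<alpha> = cd_mono n 1 \<alpha>"
  by (induction n arbitrary: \<alpha>) auto

lemma cd_mono_eq_zero_iff: "cd_mono n t \<alpha> = cd_zero n \<longleftrightarrow> t = 0"
  by (induction n arbitrary: \<alpha>) auto

lemma cd_neg_mono: "cd_neg (cd_mono n t \<alpha>) = cd_mono n (- t) \<alpha>"
  by (induction n arbitrary: \<alpha>) (auto simp: cd_neg_zero)

lemma cd_add_mono: "cd_add (cd_mono n s \<alpha>) (cd_mono n t \<alpha>) = cd_mono n (s + t) \<alpha>"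
  by (induction n arbitrary: \<alpha>) (auto simp: cd_add_zero cd_zero_carrier)

lemma cd_sub_mono: "cd_sub (cd_mono n s \<alpha>) (cd_mono n t \<alpha>) = cd_mono n (s - t) \<alpha>"
  by (simp add: cd_sub_def cd_neg_mono cd_add_mono)

section \<open>Signs of conjugates and products\<close>

definition conj_sign :: "nat set \<Rightarrow> real" where
  "conj_sign \<alpha> = (if \<alpha> = {} then 1 else - 1)"

lemma Diff_Suc_subset: "\<alpha> \<subseteq> {1..Suc n} \<Longrightarrow> \<alpha> - {Suc n} \<subseteq> {1..n}"
  by (auto simp: le_Suc_eq subset_iff)

lemma cd_conj_mono:
  "\<alpha> \<subseteq> {1..n} \<Longrightarrow> cd_conj (cd_mono n t \<alpha>) = cd_mono n (conj_sign \<alpha> * t) \<alpha>"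
proof (induction n arbitrary: \<alpha>)
  case 0
  then show ?case by (simp add: conj_sign_def)
next
  case (Suc n)
  show ?case
  proof (cases "Suc n \<in> \<alpha>")
    case True
    then have "conj_sign \<alpha> = - 1" by (auto simp: conj_sign_def)
    with True show ?thesis by (simp add: cd_conj_zero cd_neg_mono)
  next
    case False
    with Diff_Suc_subset[OF Suc.prems] have "\<alpha> \<subseteq> {1..n}" by simp
    with False Suc.IH show ?thesis by (simp add: cd_neg_zero)
  qed
qed

text \<open>The sign in \<open>o\<^sub>\<alpha> o\<^sub>\<beta> =
  \<plusminus>o\<^sub>\<gamma>\<close>. Both factors have a zero half, so each branch records the
  one surviving term among \<open>-w\<^sup>* y\<close>, \<open>y z\<^sup>*\<close>,
  \<open>w x\<close> and \<open>x z\<close> of the doubled product.\<close>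

fun mult_sign :: "nat \<Rightarrow> nat set \<Rightarrow> nat set \<Rightarrow> real" where
  "mult_sign 0 \<alpha> \<beta> = 1"
| "mult_sign (Suc n) \<alpha> \<beta> =
     (let \<alpha>' = \<alpha> - {Suc n}; \<beta>' = \<beta> - {Suc n} in
      if Suc n \<in> \<alpha>
      then if Suc n \<in> \<beta> then - conj_sign \<beta>' * mult_sign n \<beta>' \<alpha>'
           else conj_sign \<beta>' * mult_sign n \<alpha>' \<beta>'
      else if Suc n \<in> \<beta> then mult_sign n \<beta>' \<alpha>' else mult_sign n \<alpha>' \<beta>')"

lemma sym_diff_subset:
  "\<alpha> \<subseteq> C \<Longrightarrow> \<beta> \<subseteq> C \<Longrightarrow> sym_diff \<alpha> \<beta> \<subseteq> C"
  by auto

lemma sym_diff_Diff: "sym_diff \<alpha> \<beta> - {x} = sym_diff (\<alpha> - {x}) (\<beta> - {x})"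
  by auto

lemma cd_mult_mono:
  assumes "\<alpha> \<subseteq> {1..n}" "\<beta> \<subseteq> {1..n}"
  shows "cd_mult (cd_mono n s \<alpha>) (cd_mono n t \<beta>) =
    cd_mono n (s * t * mult_sign n \<alpha> \<beta>) (sym_diff \<alpha> \<beta>)"
  using assms
proof (induction n arbitrary: \<alpha> \<beta> s t)
  case 0
  then show ?case by simp
next
  case (Suc n)
  define \<alpha>' \<beta>' where defs: "\<alpha>' = \<alpha> - {Suc n}" "\<beta>' = \<beta> - {Suc n}"
  have sub: "\<alpha>' \<subseteq> {1..n}" "\<beta>' \<subseteq> {1..n}"
    using Suc.prems by (auto simp only: defs dest: Diff_Suc_subset)
  \<comment> \<open>Unlike in \<open>cd_mono.simps\<close>, both branches remove
    \<open>Suc n\<close>, so the induction hypothesis for \<open>\<alpha>'\<close> and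
    \<open>\<beta>'\<close> serves all four cases.\<close>
  have split: "cd_mono (Suc n) u \<gamma> = (if Suc n \<in> \<gamma> then Pr (cd_zero n) (cd_mono n u (\<gamma> - {Suc n}))
      else Pr (cd_mono n u (\<gamma> - {Suc n})) (cd_zero n))" for u \<gamma>
    by simp
  have comm: "sym_diff \<beta>' \<alpha>' = sym_diff \<alpha>' \<beta>'" by auto
  show ?case
    using Suc.IH[OF sub] Suc.IH[OF sub(2,1)]
    by (auto simp: split sym_diff_Diff Let_def cd_conj_zero cd_neg_zero cd_sub_def cd_add_zero
        cd_zero_carrier cd_mono_carrier cd_conj_mono[OF sub(2)] cd_neg_mono cd_mult_zero comm mult_ac
        simp flip: defs simp del: cd_mono.simps)
qed

lemma conj_sign_square:
  "conj_sign \<alpha> * conj_sign \<alpha> = 1" "conj_sign \<alpha> * (conj_sign \<alpha> * x) = x"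
  by (simp_all add: conj_sign_def)

text \<open>Splits off the top index in the inductions. It is used only in instances, since its
  right-hand side contains \<open>conj_sign\<close> again.\<close>

lemma conj_sign_Diff: "conj_sign \<alpha> = (if x \<in> \<alpha> then - 1 else conj_sign (\<alpha> - {x}))"
  by (auto simp: conj_sign_def)

text \<open>The sign form of \<open>(xy)\<^sup>* = y\<^sup>* x\<^sup>*\<close>.\<close>

lemma mult_sign_commute:
  assumes "\<alpha> \<subseteq> {1..n}" "\<beta> \<subseteq> {1..n}"
  shows "mult_sign n \<beta> \<alpha> =
    conj_sign \<alpha> * conj_sign \<beta> * conj_sign (sym_diff \<alpha> \<beta>) * mult_sign n \<alpha> \<beta>"
  using assms
proof (induction n arbitrary: \<alpha> \<beta>)
  case 0
  then show ?case by (simp add: conj_sign_def)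
next
  case (Suc n)
  define \<alpha>' \<beta>' where defs: "\<alpha>' = \<alpha> - {Suc n}" "\<beta>' = \<beta> - {Suc n}"
  have sub: "\<alpha>' \<subseteq> {1..n}" "\<beta>' \<subseteq> {1..n}"
    using Suc.prems by (auto simp only: defs dest: Diff_Suc_subset)
  note [simp] = conj_sign_Diff[where x = "Suc n" and \<alpha> = \<alpha>]
    conj_sign_Diff[where x = "Suc n" and \<alpha> = \<beta>]
    conj_sign_Diff[where x = "Suc n" and \<alpha> = "sym_diff \<alpha> \<beta>"]
  show ?case
    using Suc.IH[OF sub]
    by (auto simp: sym_diff_Diff Let_def mult_ac conj_sign_square simp flip: defs)
qed

text \<open>If \<open>Suc n\<close> lies in \<open>\<alpha>\<close>, the two conjugation signs
  cancel and the minus sign of \<open>-w\<^sup>* y\<close> remains.\<close>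

lemma mult_sign_self:
  assumes "\<alpha> \<subseteq> {1..n}"
  shows "mult_sign n \<alpha> \<alpha> = conj_sign \<alpha>"
  using assms
proof (induction n arbitrary: \<alpha>)
  case 0
  then show ?case by (simp add: conj_sign_def)
next
  case (Suc n)
  define \<alpha>' where defs: "\<alpha>' = \<alpha> - {Suc n}"
  show ?case
    using Suc.IH[OF Diff_Suc_subset[OF Suc.prems]]
    by (simp add: Let_def conj_sign_square conj_sign_Diff[where x = "Suc n" and \<alpha> = \<alpha>]
        flip: defs)
qed

lemma abs_mult_sign: "\<bar>mult_sign n \<alpha> \<beta>\<bar> = 1"
  by (induction n arbitrary: \<alpha> \<beta>) (auto simp: Let_def abs_mult conj_sign_def)

text \<open>The sign form of \<open>(xy)y\<^sup>* = x\<close>.\<close>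

lemma mult_sign_cancel_right:
  assumes "\<alpha> \<subseteq> {1..n}" "\<beta> \<subseteq> {1..n}"
  shows "mult_sign n \<alpha> \<beta> * mult_sign n (sym_diff \<alpha> \<beta>) \<beta> = conj_sign \<beta>"
  using assms
proof (induction n arbitrary: \<alpha> \<beta>)
  case 0
  then show ?case by (simp add: conj_sign_def)
next
  case (Suc n)
  define \<alpha>' \<beta>' where defs: "\<alpha>' = \<alpha> - {Suc n}" "\<beta>' = \<beta> - {Suc n}"
  have sub: "\<alpha>' \<subseteq> {1..n}" "\<beta>' \<subseteq> {1..n}"
    using Suc.prems by (auto simp only: defs dest: Diff_Suc_subset)
  have right: "mult_sign n \<alpha>' \<beta>' * mult_sign n (sym_diff \<alpha>' \<beta>') \<beta>' = conj_sign \<beta>'"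
    by (rule Suc.IH[OF sub])
  have "sym_diff (sym_diff \<alpha>' \<beta>') \<beta>' = \<alpha>'" by blast
  \<comment> \<open>The mirror identity \<open>y\<^sup>*(yx) = x\<close>, obtained from
    \<open>right\<close> by commuting both products. It is needed when \<open>Suc n\<close> lies in
    \<open>\<beta>\<close>, because doubling then moves \<open>\<beta>'\<close> to the left.\<close>
  then have left: "mult_sign n \<beta>' \<alpha>' * mult_sign n \<beta>' (sym_diff \<alpha>' \<beta>') = conj_sign \<beta>'"
    using mult_sign_commute[OF sub] mult_sign_commute[OF sym_diff_subset[OF sub] sub(2)] right
    by (simp add: mult_ac conj_sign_square)
  note [simp] = conj_sign_Diff[where x = "Suc n" and \<alpha> = \<beta>]
  show ?case
    using left right
    by (auto simp: sym_diff_Diff Let_def mult_ac conj_sign_square simp flip: defs)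
qed

text \<open>All three conjugation signs in \<open>mult_sign_commute\<close> are -1; distinctness
  makes the product pure as well.\<close>

lemma mult_sign_anticommute:
  assumes "\<alpha> \<subseteq> {1..n}" "\<beta> \<subseteq> {1..n}" "\<alpha> \<noteq> {}" "\<beta> \<noteq> {}" "\<alpha> \<noteq> \<beta>"
  shows "mult_sign n \<beta> \<alpha> = - mult_sign n \<alpha> \<beta>"
proof -
  have "sym_diff \<alpha> \<beta> \<noteq> {}" using assms(5) by blast
  then have "conj_sign \<alpha> = - 1" "conj_sign \<beta> = - 1" "conj_sign (sym_diff \<alpha> \<beta>) = - 1"
    using assms(3,4) by (simp_all only: conj_sign_def if_False)
  then show ?thesis
    using mult_sign_commute[OF assms(1,2)] by simp
qed

section \<open>Associators of basis elements\<close>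

definition assoc_coeff :: "nat \<Rightarrow> nat set \<Rightarrow> nat set \<Rightarrow> nat set \<Rightarrow> real" where
  "assoc_coeff n \<alpha> \<beta> \<gamma> =
     mult_sign n \<alpha> \<beta> * mult_sign n (sym_diff \<alpha> \<beta>) \<gamma> -
     mult_sign n \<beta> \<gamma> * mult_sign n \<alpha> (sym_diff \<beta> \<gamma>)"

text \<open>Symmetric difference is associative, so both bracketings are multiples of the same basis
  element.\<close>

lemma cd_assoc_basis:
  assumes "\<alpha> \<subseteq> {1..n}" "\<beta> \<subseteq> {1..n}" "\<gamma> \<subseteq> {1..n}"
  shows "cd_assoc (cd_basis n \<alpha>) (cd_basis n \<beta>) (cd_basis n \<gamma>) =
    cd_mono n (assoc_coeff n \<alpha> \<beta> \<gamma>) (sym_diff (sym_diff \<alpha> \<beta>) \<gamma>)"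
proof -
  have "sym_diff \<alpha> (sym_diff \<beta> \<gamma>) = sym_diff (sym_diff \<alpha> \<beta>) \<gamma>" by blast
  then show ?thesis
    by (simp only: cd_assoc_def cd_basis_eq_mono cd_mult_mono assms sym_diff_subset cd_sub_mono
        assoc_coeff_def mult_1 mult_1_right)
qed

text \<open>The third element is \<open>z = \<plusminus>xy\<close>. Then \<open>yz\<close> carries
  the same sign as \<open>xy\<close>, so both bracketings are that sign times the square -1 of a
  pure element.\<close>

lemma assoc_coeff_quaternionic:
  assumes "\<alpha> \<subseteq> {1..n}" "\<beta> \<subseteq> {1..n}" "\<alpha> \<noteq> {}" "\<beta> \<noteq> {}" "\<alpha> \<noteq> \<beta>"
  shows "assoc_coeff n \<alpha> \<beta> (sym_diff \<alpha> \<beta>) = 0"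
proof -
  let ?\<gamma> = "sym_diff \<alpha> \<beta>"
  have eqs: "sym_diff \<beta> ?\<gamma> = \<alpha>" "sym_diff \<beta> \<alpha> = ?\<gamma>" by blast+
  have \<gamma>: "?\<gamma> \<subseteq> {1..n}" "?\<gamma> \<noteq> {}" "?\<gamma> \<noteq> \<beta>" using assms by blast+
  have "mult_sign n \<alpha> \<beta> * mult_sign n ?\<gamma> \<beta> = - 1"
    using mult_sign_cancel_right[OF assms(1,2)] assms(4) by (simp add: conj_sign_def)
  then have "mult_sign n \<beta> ?\<gamma> = mult_sign n \<alpha> \<beta>"
    using mult_sign_anticommute[OF \<gamma>(1) assms(2) \<gamma>(2) assms(4) \<gamma>(3)]
      abs_mult_sign[of n \<alpha> \<beta>] by (auto simp: abs_if split: if_splits)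
  moreover have "mult_sign n ?\<gamma> ?\<gamma> = - 1" "mult_sign n \<alpha> \<alpha> = - 1"
    unfolding mult_sign_self[OF \<gamma>(1)] mult_sign_self[OF assms(1)] conj_sign_def
      if_not_P[OF \<gamma>(2)] if_not_P[OF assms(3)] by (rule refl)+
  ultimately show ?thesis
    unfolding assoc_coeff_def eqs by simp
qed

section \<open>The natural order on index sets\<close>

lemma basis_less_cd_basis:
  assumes "basis_less n (cd_basis n \<alpha>) (cd_basis n \<beta>)" "\<alpha> \<subseteq> {1..n}" "\<beta> \<subseteq> {1..n}"
  shows "\<alpha> \<noteq> \<beta>" "Max (sym_diff \<alpha> \<beta>) \<in> \<beta>"
proof -
  from assms(1) obtain \<alpha>' \<beta>' where sub: "\<alpha>' \<subseteq> {1..n}" "\<beta>' \<subseteq> {1..n}"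
    and eq: "cd_basis n \<alpha> = cd_basis n \<alpha>'" "cd_basis n \<beta> = cd_basis n \<beta>'"
    and less: "\<alpha>' \<noteq> \<beta>'" "Max (sym_diff \<alpha>' \<beta>') \<in> \<beta>'"
    unfolding basis_less_def by blast
  have "\<alpha> = \<alpha>'" "\<beta> = \<beta>'"
    using inj_onD[OF inj_on_cd_basis eq(1)] inj_onD[OF inj_on_cd_basis eq(2)] assms(2,3) sub
    by blast+
  with less show "\<alpha> \<noteq> \<beta>" "Max (sym_diff \<alpha> \<beta>) \<in> \<beta>" by blast+
qed

text \<open>Otherwise the largest element of the symmetric difference would lie in both
  sets.\<close>

lemma basis_less_asym:
  assumes "basis_less n (cd_basis n \<alpha>) (cd_basis n \<beta>)" "\<alpha> \<subseteq> {1..n}" "\<beta> \<subseteq> {1..n}"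
  shows "\<not> basis_less n (cd_basis n \<beta>) (cd_basis n \<alpha>)"
proof
  assume "basis_less n (cd_basis n \<beta>) (cd_basis n \<alpha>)"
  then have "Max (sym_diff \<beta> \<alpha>) \<in> \<alpha>"
    using assms(2,3) basis_less_cd_basis(2) by blast
  moreover have "sym_diff \<beta> \<alpha> = sym_diff \<alpha> \<beta>" by blast
  ultimately have "Max (sym_diff \<alpha> \<beta>) \<in> \<alpha> \<inter> \<beta>"
    using basis_less_cd_basis(2)[OF assms] by simp
  moreover have "Max (sym_diff \<alpha> \<beta>) \<in> sym_diff \<alpha> \<beta>"
  proof (rule Max_in)
    show "finite (sym_diff \<alpha> \<beta>)"
      using assms(2,3) by (meson finite_atLeastAtMost finite_subset sym_diff_subset)
    show "sym_diff \<alpha> \<beta> \<noteq> {}"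
      using basis_less_cd_basis(1)[OF assms] by blast
  qed
  ultimately show False by blast
qed

theorem theorem5:
  fixes n :: nat and b c d :: cd
  assumes "n \<ge> 2"
    and "nonassociative_triad n b c d"
  shows "(type1_assoc b c d \<noteq> cd_zero n \<and> type2_assoc b c d \<noteq> cd_zero n \<and> type3_assoc b c d \<noteq> cd_zero n) \<or>
         (type1_assoc b c d \<noteq> cd_zero n \<and> type2_assoc b c d = cd_zero n \<and> type3_assoc b c d = cd_zero n) \<or>
         (type1_assoc b c d = cd_zero n \<and> type2_assoc b c d \<noteq> cd_zero n \<and> type3_assoc b c d = cd_zero n) \<or>
         (type1_assoc b c d = cd_zero n \<and> type2_assoc b c d = cd_zero n \<and> type3_assoc b c d \<noteq> cd_zero n)"
proof -
  have tri: "triad n b c d" and nz: "triple_assoc b c d \<noteq> cd_zero n"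
    using assms(2) by (auto simp: nonassociative_triad_def)
  from tri obtain \<alpha> \<beta> \<gamma> where
    b: "b = cd_basis n \<alpha>" and \<alpha>: "\<alpha> \<subseteq> {1..n}" "\<alpha> \<noteq> {}" and
    c: "c = cd_basis n \<beta>" and \<beta>: "\<beta> \<subseteq> {1..n}" "\<beta> \<noteq> {}" and
    d: "d = cd_basis n \<gamma>" and \<gamma>: "\<gamma> \<subseteq> {1..n}" "\<gamma> \<noteq> {}"
    by (auto simp: triad_def pure_basis_def)
  have less: "basis_less n b c" "basis_less n c d"
    using tri by (auto simp: triad_def)
  \<comment> \<open>If \<open>\<alpha> = \<gamma>\<close>, then \<open>b < c\<close> and
    \<open>c < b\<close>, against asymmetry.\<close>
  have neq: "\<alpha> \<noteq> \<beta>" "\<beta> \<noteq> \<gamma>" "\<alpha> \<noteq> \<gamma>"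
    using less basis_less_cd_basis(1) basis_less_asym \<alpha> \<beta> \<gamma> by (auto simp: b c d)
  let ?s = "mult_sign n"
  let ?\<delta> = "sym_diff (sym_diff \<alpha> \<beta>) \<gamma>"
  have perm: "sym_diff (sym_diff \<alpha> \<gamma>) \<beta> = ?\<delta>" "sym_diff (sym_diff \<gamma> \<beta>) \<alpha> = ?\<delta>"
    "sym_diff (sym_diff \<beta> \<alpha>) \<gamma> = ?\<delta>" by blast+
  have assocs: "cd_assoc b d c = cd_mono n (assoc_coeff n \<alpha> \<gamma> \<beta>) ?\<delta>"
    "cd_assoc b c d = cd_mono n (assoc_coeff n \<alpha> \<beta> \<gamma>) ?\<delta>"
    "cd_assoc c b d = cd_mono n (assoc_coeff n \<beta> \<alpha> \<gamma>) ?\<delta>"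
    "cd_assoc d c b = cd_mono n (assoc_coeff n \<gamma> \<beta> \<alpha>) ?\<delta>"
    unfolding b c d by (simp_all only: cd_assoc_basis \<alpha> \<beta> \<gamma> perm)
  have "triple_assoc b c d = cd_mono n (assoc_coeff n \<alpha> \<gamma> \<beta> -
      assoc_coeff n \<gamma> \<beta> \<alpha> + assoc_coeff n \<beta> \<alpha> \<gamma>) ?\<delta>"
    unfolding triple_assoc_def assocs cd_sub_mono cd_add_mono by (rule refl)
  with nz have coeff: "assoc_coeff n \<alpha> \<gamma> \<beta> - assoc_coeff n \<gamma> \<beta> \<alpha> + assoc_coeff n \<beta> \<alpha> \<gamma> \<noteq> 0"
    by (simp only: cd_mono_eq_zero_iff not_False_eq_True)
  have \<gamma>_neq: "\<gamma> \<noteq> sym_diff \<alpha> \<beta>"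
  proof
    assume "\<gamma> = sym_diff \<alpha> \<beta>"
    \<comment> \<open>Every ordering of the three sets is again of the quaternionic form.\<close>
    then have eqs: "\<beta> = sym_diff \<alpha> \<gamma>" "\<alpha> = sym_diff \<gamma> \<beta>" "\<gamma> = sym_diff \<beta> \<alpha>" by blast+
    have "assoc_coeff n \<alpha> \<gamma> \<beta> = 0" "assoc_coeff n \<gamma> \<beta> \<alpha> = 0" "assoc_coeff n \<beta> \<alpha> \<gamma> = 0"
      using assoc_coeff_quaternionic[OF \<alpha>(1) \<gamma>(1) \<alpha>(2) \<gamma>(2) neq(3), folded eqs(1)]
        assoc_coeff_quaternionic[OF \<gamma>(1) \<beta>(1) \<gamma>(2) \<beta>(2) neq(2)[symmetric], folded eqs(2)]
        assoc_coeff_quaternionic[OF \<beta>(1) \<alpha>(1) \<beta>(2) \<alpha>(2) neq(1)[symmetric], folded eqs(3)]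
      by blast+
    with coeff show False by simp
  qed
  define A B C where ABC: "A = ?s \<beta> \<gamma> * ?s \<alpha> (sym_diff \<beta> \<gamma>)"
    "B = ?s \<alpha> \<gamma> * ?s \<beta> (sym_diff \<alpha> \<gamma>)"
    "C = ?s \<alpha> \<beta> * ?s (sym_diff \<alpha> \<beta>) \<gamma>"
  have "\<bar>A\<bar> = 1" "\<bar>B\<bar> = 1" "\<bar>C\<bar> = 1"
    by (simp_all add: ABC abs_mult abs_mult_sign)
  then have pm: "A = 1 \<or> A = - 1" "B = 1 \<or> B = - 1" "C = 1 \<or> C = - 1"
    by (auto simp: abs_if split: if_splits)
  have anti: "?s \<beta> \<alpha> = - ?s \<alpha> \<beta>" "?s \<gamma> \<beta> = - ?s \<beta> \<gamma>"
    using mult_sign_anticommute[OF \<alpha>(1) \<beta>(1) \<alpha>(2) \<beta>(2) neq(1)]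
      mult_sign_anticommute[OF \<beta>(1) \<gamma>(1) \<beta>(2) \<gamma>(2) neq(2)] by blast+
  \<comment> \<open>Here \<open>\<gamma>_neq\<close> enters: \<open>bd\<close> anticommutes with
    \<open>c\<close> because it is not \<open>\<plusminus>c\<close>.\<close>
  have "sym_diff \<alpha> \<gamma> \<subseteq> {1..n}" "sym_diff \<alpha> \<gamma> \<noteq> {}" "sym_diff \<alpha> \<gamma> \<noteq> \<beta>"
    using \<alpha> \<gamma> neq \<gamma>_neq by blast+
  then have anti': "?s (sym_diff \<alpha> \<gamma>) \<beta> = - ?s \<beta> (sym_diff \<alpha> \<gamma>)"
    using mult_sign_anticommute[OF \<beta>(1) _ \<beta>(2)] by metis
  have comm: "sym_diff \<gamma> \<beta> = sym_diff \<beta> \<gamma>" "sym_diff \<beta> \<alpha> = sym_diff \<alpha> \<beta>" by blast+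
  have coeffs_ABC: "assoc_coeff n \<alpha> \<gamma> \<beta> = A - B" "assoc_coeff n \<alpha> \<beta> \<gamma> = C - A"
    "assoc_coeff n \<beta> \<alpha> \<gamma> = - C - B"
    unfolding assoc_coeff_def comm anti anti' ABC by simp_all
  show ?thesis
    unfolding type1_assoc_def type2_assoc_def type3_assoc_def assocs
      cd_mono_eq_zero_iff coeffs_ABC
    \<comment> \<open>Eight sign patterns remain. The coefficients lie in {-2, 0, 2} and sum to
      \<open>-2B\<close>, so an odd number of them is non-zero.\<close>
    using pm by auto
qed

end
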